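(* Let $\mathbb{X}$ be a reflexive Banach space and let $\mathbb{Y}$ be any Banach space. Let $T, A \in K(\mathbb{X}, \mathbb{Y})$ be such that $T \notin \mathrm{span}\{A\}$. Let $\lambda_0 A$ be a best approximation to $T$ out of $\mathrm{span}\{A\}$. Assume also that $M_{T-\lambda_0 A} = \pm D$, where $D$ is a connected subset of $S_{\mathbb{X}}$. Then there exists a semi-inner-product $[\cdot,\cdot]$ on $\mathbb{Y}$ such that $$\mathrm{dist}(T, \mathrm{span}\{A\}) = \max\{|[Tx, y]| : x \in S_{\mathbb{X}},\ y \in S_{\mathbb{Y}},\ [Ax, y] = 0\}.$$
   Context: All Banach spaces are real. $S_{\mathbb{X}}$ is the unit sphere of $\mathbb{X}$. $K(\mathbb{X},\mathbb{Y})$ is the Banach space of compact linear operators from $\mathbb{X}$ to $\mathbb{Y}$ with the operator norm. For $T \in K(\mathbb{X},\mathbb{Y})$, $M_T = \{x \in S_{\mathbb{X}} : \|Tx\| = \|T\|\}$ is the norm attainment set. For a set $D$, $\pm D = D \cup (-D)$. For an element $x$ and a subspace $\mathbb{V}$ of a Banach space, $\mathrm{dist}(x,\mathbb{V}) = \inf\{\|x-z\| : z\in\mathbb{V}\}$, and $y \in \mathbb{V}$ is a best approximation to $x$ out of $\mathbb{V}$ if $\|x-y\| = \min\{\|x-z\| : z \in \mathbb{V}\}$. A semi-inner-product (s.i.p.) on a real Banach space $\mathbb{Y}$ is a function $[\cdot,\cdot] : \mathbb{Y}\times\mathbb{Y} \to \mathbb{R}$ such that for all $\alpha,\beta\in\mathbb{R}$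 and $x,y,z\in\mathbb{Y}$: (a) $[\alpha x+\beta y, z] = \alpha[x,z]+\beta[y,z]$; (b) $[x,x]>0$ whenever $x\neq 0$; (c) $|[x,y]|^2 \leq [x,x][y,y]$; (d) $[x,\alpha y] = \alpha[x,y]$. Every s.i.p. is assumed compatible with the norm: $[x,x] = \|x\|^2$ for all $x$. *)

theory Defs
  imports "HOL-Analysis.Analysis"
begin

text \<open>Reflexivity: the canonical embedding of the space into its bidual, which sends \<open>x\<close> to
  the evaluation functional \<open>\<lambda>f. f x\<close>, is surjective.\<close>

definition reflexive_space :: "'a::real_normed_vector itself \<Rightarrow> bool" where
  "reflexive_space X \<longleftrightarrow>
     (\<forall>F :: ('a \<Rightarrow>\<^sub>L real) \<Rightarrow>\<^sub>L real. \<exists>x :: 'a. \<forall>f. blinfun_apply F f = blinfun_apply f x)"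

definition compact_operators :: "('a::real_normed_vector \<Rightarrow>\<^sub>L 'b::real_normed_vector) set" where
  "compact_operators = {T. compact (closure (blinfun_apply T ` cball 0 1))}"

definition norm_attainment_set ::
    "('a::real_normed_vector \<Rightarrow>\<^sub>L 'b::real_normed_vector) \<Rightarrow> 'a set" where
  "norm_attainment_set T = {x \<in> sphere 0 1. norm (blinfun_apply T x) = norm T}"

definition best_approximation :: "'a::real_normed_vector \<Rightarrow> 'a set \<Rightarrow> 'a \<Rightarrow> bool" where
  "best_approximation x V y \<longleftrightarrow> y \<in> V \<and> (\<forall>z\<in>V. norm (x - y) \<le> norm (x - z))"

text \<open>The last conjunct is compatibility with the norm.\<close>

definition semi_inner_product :: "('a::real_normed_vector \<Rightarrow> 'a \<Rightarrow> real) \<Rightarrow> bool" where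
  "semi_inner_product p \<longleftrightarrow>
     (\<forall>a b x y z. p (a *\<^sub>R x + b *\<^sub>R y) z = a * p x z + b * p y z) \<and>
     (\<forall>x. x \<noteq> 0 \<longrightarrow> p x x > 0) \<and>
     (\<forall>x y. \<bar>p x y\<bar>\<^sup>2 \<le> p x x * p y y) \<and>
     (\<forall>a x y. p x (a *\<^sub>R y) = a * p x y) \<and>
     (\<forall>x. p x x = (norm x)\<^sup>2)"

text \<open>An attained maximum of a possibly infinite set (\<open>Max\<close> is only meaningful on finite sets).\<close>

definition is_maximum :: "'a::order \<Rightarrow> 'a set \<Rightarrow> bool" where
  "is_maximum m S \<longleftrightarrow> m \<in> S \<and> (\<forall>s\<in>S. s \<le> m)"

end

theory Submission
  imports Defs
begin

text \<open>
  Put \<open>S = T - \<lambda>\<^sub>0 A\<close>, so that \<open>dist(T, span {A}) = \<parallel>S\<parallel>\<close> and \<open>S\<close> is Birkhoff--James orthogonal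
  to \<open>A\<close>, i.e. \<open>\<parallel>S\<parallel> \<le> \<parallel>S + t A\<parallel>\<close> for all real \<open>t\<close>. The heart of the proof is to pass from this
  orthogonality of operators to orthogonality at a point: there is \<open>x\<close> in the norm attainment set
  of \<open>S\<close> such that \<open>S x\<close> is Birkhoff--James orthogonal to \<open>A x\<close>
  (\<open>norm_attained_with_birkhoff_orthogonal\<close>). Given such an \<open>x\<close>, the Hahn--Banach theorem yields a
  functional \<open>f\<close> of norm one with \<open>f (S x) = \<parallel>S\<parallel>\<close> and \<open>f (A x) = 0\<close>, and there is a semi-inner
  product with \<open>[\<cdot>, w] = f\<close> for the unit vector \<open>w = S x / \<parallel>S\<parallel>\<close>. Then \<open>[A x, w] = 0\<close> and
  \<open>[T x, w] = [S x, w] = \<parallel>S\<parallel>\<close>, while any admissible pair satisfies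
  \<open>\<bar>[T x', y']\<bar> = \<bar>[S x', y']\<bar> \<le> \<parallel>S\<parallel>\<close> by the Cauchy--Schwarz inequality.

  The point \<open>x\<close> is found by connectedness. For every \<open>x\<close>, convexity of the norm gives
  \<open>\<parallel>S x\<parallel> \<le> \<parallel>S x + t A x\<parallel>\<close> for all \<open>t \<ge> 0\<close> or for all \<open>t \<le> 0\<close>. The two alternatives define closed
  sets, symmetric about the origin, and a common point of both and \<open>D\<close> is what is wanted; so it
  suffices that each of them meets the norm attainment set
  (\<open>norm_attained_with_ray_nondecreasing\<close>). Such a point \<open>x\<close> comes from vectors \<open>x\<^sub>n\<close> at
  which \<open>S \<plusminus> \<epsilon>\<^sub>n A\<close> almost attains its norm, where \<open>\<epsilon>\<^sub>n \<rightarrow> 0\<close>: along a subsequence,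
  \<open>S x\<^sub>n \<rightarrow> S x\<close> and \<open>A x\<^sub>n \<rightarrow> A x\<close> in norm.

  This passage to the limit is the only use of reflexivity and compactness, and it does not need weak sequential
  compactness: by compactness the pairs \<open>(T x\<^sub>n, A x\<^sub>n)\<close> have a convergent subsequence, and by
  reflexivity the image of the closed unit ball under \<open>x \<mapsto> (T x, A x)\<close> is closed
  (\<open>reflexive_image_cball_closed\<close>). Every extension of functionals is an instance of one
  form of the Hahn--Banach theorem, \<open>norm_dominated_functional_on_cone\<close>.
\<close>

section \<open>Sublinear functionals and the Hahn--Banach theorem\<close>

text \<open>Subadditive and positively homogeneous real functionals.\<close>

definition sublinear :: "('a::real_vector \<Rightarrow> real) \<Rightarrow> bool" where
  "sublinear p \<longleftrightarrow> (\<forall>x y. p (x + y) \<le> p x + p y) \<and> (\<forall>t x. 0 \<le> t \<longrightarrow> p (t *\<^sub>R x) = t * p x)"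

lemma sublinearI:
  fixes p :: "'a::real_vector \<Rightarrow> real"
  assumes add: "\<And>x y. p (x + y) \<le> p x + p y"
    and zero: "p 0 = 0"
    and scale: "\<And>t x. 0 < t \<Longrightarrow> p (t *\<^sub>R x) \<le> t * p x"
  shows "sublinear p"
proof -
  have "p (t *\<^sub>R x) = t * p x" if "0 \<le> t" for t x
  proof (cases "t = 0")
    case False
    with that have t: "0 < t" by simp
    have "p x \<le> inverse t * p (t *\<^sub>R x)"
      using scale[of "inverse t" "t *\<^sub>R x"] t by simp
    then have "t * p x \<le> p (t *\<^sub>R x)"
      using t by (simp add: field_simps)
    with scale[OF t] show ?thesis by (simp add: order_antisym)
  qed (simp add: zero)
  with add show ?thesis by (simp add: sublinear_def)
qed

lemma
  assumes "sublinear p"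
  shows sublinear_add: "p (x + y) \<le> p x + p y"
    and sublinear_scale: "0 \<le> t \<Longrightarrow> p (t *\<^sub>R x) = t * p x"
  using assms by (auto simp: sublinear_def)

lemma sublinear_zero: "sublinear p \<Longrightarrow> p 0 = 0"
  using sublinear_scale[of p 0 0] by simp

lemma sublinear_minus: "sublinear p \<Longrightarrow> - p (- x) \<le> p x"
  using sublinear_add[of p x "- x"] sublinear_zero[of p] by simp

lemma sublinear_norm: "sublinear (norm :: 'a::real_normed_vector \<Rightarrow> real)"
  by (simp add: sublinear_def norm_triangle_ineq)

text \<open>Convex cones, containing the origin, in the product of the space with the real line. A pair \<open>(c, r)\<close> in such a cone
  encodes the constraint \<open>r \<le> f c\<close> on a linear functional \<open>f\<close>.\<close>

definition convex_cone_pairs :: "('a::real_vector \<times> real) set \<Rightarrow> bool" where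
  "convex_cone_pairs C \<longleftrightarrow> 0 \<in> C \<and> (\<forall>u\<in>C. \<forall>v\<in>C. u + v \<in> C) \<and> (\<forall>t>0. \<forall>u\<in>C. t *\<^sub>R u \<in> C)"

text \<open>The functional \<open>q x = inf {p (x + c) - r | (c, r) \<in> C}\<close> is sublinear, and every linear functional
  below it satisfies all the constraints in \<open>C\<close>. The hypothesis \<open>r \<le> p c\<close> bounds the infimum from below
  by \<open>- p (- x)\<close>. The cone \<open>{(t y, t p y) | t \<ge> 0}\<close> shows that a minimal
  sublinear functional is linear; larger cones prescribe the functional on a subspace.\<close>

lemma sublinear_cone_reduction:
  fixes p :: "'a::real_vector \<Rightarrow> real"
  assumes p: "sublinear p" and C: "convex_cone_pairs C"
    and dom: "\<And>c r. (c, r) \<in> C \<Longrightarrow> r \<le> p c"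
  obtains q where "sublinear q" "\<And>x. q x \<le> p x" "\<And>c r. (c, r) \<in> C \<Longrightarrow> q (- c) \<le> - r"
proof -
  define h where "h x u = p (x + fst u) - snd u" for x and u :: "'a \<times> real"
  define q where "q x = (INF u\<in>C. h x u)" for x
  have C0: "(0, 0) \<in> C" using C by (auto simp: convex_cone_pairs_def zero_prod_def)
  have low: "- p (- x) \<le> h x u" if "u \<in> C" for x u
    using sublinear_add[OF p, of "x + fst u" "- x"] dom[of "fst u" "snd u"] that
    by (simp add: h_def)
  have bdd: "bdd_below (h x ` C)" for x
    using low by (intro bdd_belowI2)
  have le: "q x \<le> h x u" if "u \<in> C" for x u
    unfolding q_def using bdd that by (rule cINF_lower)
  have ge: "m \<le> q x" if "\<And>u. u \<in> C \<Longrightarrow> m \<le> h x u" for m x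
    unfolding q_def using C0 that by (intro cINF_greatest) auto
  have q_le: "q x \<le> p x" for x
    using le[OF C0, of x] by (simp add: h_def)
  have "q (x + y) \<le> q x + q y" for x y
  proof -
    have "q (x + y) \<le> h x u + h y v" if "u \<in> C" "v \<in> C" for u v
    proof -
      have "u + v \<in> C" using C that by (auto simp: convex_cone_pairs_def)
      from le[OF this, of "x + y"] show ?thesis
        using sublinear_add[OF p, of "x + fst u" "y + fst v"]
        by (simp add: h_def algebra_simps)
    qed
    then have "q (x + y) - h y v \<le> q x" if "v \<in> C" for v
      using that by (intro ge) (simp add: diff_le_eq)
    then have "q (x + y) - q x \<le> q y"
      by (intro ge) (simp add: algebra_simps)
    then show ?thesis by simp
  qed
  moreover have "q 0 = 0"
    using q_le[of 0] ge[of 0 0] dom by (simp add: sublinear_zero[OF p] h_def split_paired_all)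
  moreover have "q (t *\<^sub>R x) \<le> t * q x" if t: "0 < t" for t x
  proof -
    have "q (t *\<^sub>R x) / t \<le> q x"
    proof (rule ge)
      fix u assume "u \<in> C"
      then have "t *\<^sub>R u \<in> C" using C t by (auto simp: convex_cone_pairs_def)
      from le[OF this, of "t *\<^sub>R x"] have "q (t *\<^sub>R x) \<le> t * h x u"
        using sublinear_scale[OF p, of t "x + fst u"] t
        by (simp add: h_def scaleR_add_right right_diff_distrib)
      then show "q (t *\<^sub>R x) / t \<le> h x u" using t by (simp add: field_simps)
    qed
    then show ?thesis using t by (simp add: field_simps)
  qed
  ultimately have "sublinear q" by (intro sublinearI)
  moreover have "q (- c) \<le> - r" if "(c, r) \<in> C" for c r
    using le[OF that, of "- c"] by (simp add: h_def sublinear_zero[OF p])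
  ultimately show thesis using q_le that by blast
qed

lemma minimal_sublinear_linear:
  fixes q :: "'a::real_vector \<Rightarrow> real"
  assumes q: "sublinear q"
    and min: "\<And>s. sublinear s \<Longrightarrow> (\<And>x. s x \<le> q x) \<Longrightarrow> s = q"
  shows "linear q"
proof -
  have neg: "q (- y) = - q y" for y
  proof -
    define C where "C = {(t *\<^sub>R y, t * q y) | t. 0 \<le> t}"
    have "convex_cone_pairs C"
      unfolding convex_cone_pairs_def C_def
      by (auto simp: zero_prod_def plus_prod_def scaleR_prod_def
          scaleR_add_left[symmetric] distrib_right[symmetric])
    moreover have "r \<le> q c" if "(c, r) \<in> C" for c r
      using that by (auto simp: C_def sublinear_scale[OF q])
    ultimately obtain s where s: "sublinear s" "\<And>x. s x \<le> q x"
      and sC: "\<And>c r. (c, r) \<in> C \<Longrightarrow> s (- c) \<le> - r"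
      using sublinear_cone_reduction[OF q] by blast
    have "(y, q y) \<in> C" by (auto simp: C_def intro!: exI[of _ 1])
    from sC[OF this] have "q (- y) \<le> - q y" using min[OF s] by simp
    moreover have "- q y \<le> q (- y)" using sublinear_minus[OF q, of y] by simp
    ultimately show ?thesis by simp
  qed
  have add: "q (x + y) = q x + q y" for x y
    using sublinear_add[OF q, of x y] sublinear_add[OF q, of "- x" "- y"]
      neg[of "x + y"] neg[of x] neg[of y] by simp
  have "q (t *\<^sub>R x) = t * q x" for t x
  proof (cases "0 \<le> t")
    case False
    then have "q (t *\<^sub>R x) = - q ((- t) *\<^sub>R x)" using neg[of "t *\<^sub>R x"] by simp
    also have "\<dots> = t * q x" using sublinear_scale[OF q, of "- t" x] False by simp
    finally show ?thesis .
  qed (rule sublinear_scale[OF q])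
  with add show ?thesis by (intro linearI) auto
qed

text \<open>The pointwise infimum of a chain of sublinear functionals below \<open>p\<close> is sublinear, as it is bounded
  below by \<open>- p (- x)\<close>; hence there is a minimal one, and it is linear.\<close>

lemma sublinear_dominates_linear:
  fixes p :: "'a::real_vector \<Rightarrow> real"
  assumes p: "sublinear p"
  obtains f where "linear f" "\<And>x. f x \<le> p x"
proof -
  define Q where "Q = {q. sublinear q \<and> (\<forall>x. q x \<le> p x)}"
  \<comment> \<open>The reversed pointwise order, whose maximal elements are the minimal functionals.\<close>
  define R where "R f g \<longleftrightarrow> (\<forall>x. g x \<le> f x)" for f g :: "'a \<Rightarrow> real"
  have "partial_order_on Q (relation_of R Q)"
    by (rule partial_order_on_relation_ofI)
       (auto simp: R_def intro: order_trans order_antisym intro!: ext[of "_ :: 'a \<Rightarrow> real"])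
  moreover have "\<exists>u\<in>Q. \<forall>q\<in>K. R q u" if K: "K \<in> Chains (relation_of R Q)" for K
  proof (cases "K = {}")
    case True
    have "p \<in> Q" using p by (simp add: Q_def)
    with True show ?thesis by blast
  next
    case False
    have KQ: "q \<in> Q" if "q \<in> K" for q
      using K that by (auto simp: Chains_def relation_of_def)
    have chain: "(\<forall>x. q x \<le> s x) \<or> (\<forall>x. s x \<le> q x)" if "q \<in> K" "s \<in> K" for q s
      using K that by (auto simp: Chains_def relation_of_def R_def)
    define u where "u x = (INF q\<in>K. q x)" for x
    have low: "- p (- x) \<le> q x" if "q \<in> K" for q x
      using sublinear_minus[of q x] KQ[OF that] by (auto simp: Q_def intro: order_trans[rotated])
    have bdd: "bdd_below ((\<lambda>q. q x) ` K)" for x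
      using low by (intro bdd_belowI2)
    have le: "u x \<le> q x" if "q \<in> K" for x q
      unfolding u_def using bdd that by (rule cINF_lower)
    have ge: "m \<le> u x" if "\<And>q. q \<in> K \<Longrightarrow> m \<le> q x" for m x
      unfolding u_def using False that by (intro cINF_greatest) auto
    have sub: "sublinear q" if "q \<in> K" for q using KQ[OF that] by (simp add: Q_def)
    have "u (x + y) \<le> u x + u y" for x y
    proof -
      have key: "u (x + y) \<le> q x + s y" if qs: "q \<in> K" "s \<in> K" for q s
        using chain[OF qs]
      proof
        assume "\<forall>x. q x \<le> s x"
        then show ?thesis
          using le[OF qs(1), of "x + y"] sublinear_add[OF sub[OF qs(1)], of x y]
          by (smt (verit))
      next
        assume "\<forall>x. s x \<le> q x"
        then show ?thesis
          using le[OF qs(2), of "x + y"] sublinear_add[OF sub[OF qs(2)], of x y]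
          by (smt (verit))
      qed
      then have "u (x + y) - s y \<le> u x" if "s \<in> K" for s
        using that by (intro ge) (simp add: diff_le_eq)
      then have "u (x + y) - u x \<le> u y"
        by (intro ge) (simp add: algebra_simps)
      then show ?thesis by simp
    qed
    moreover have "u 0 = 0"
    proof -
      obtain q where "q \<in> K" using False by blast
      then show ?thesis
        using le[of q 0] ge[of 0 0] sub by (auto simp: sublinear_zero intro: order_antisym)
    qed
    moreover have "u (t *\<^sub>R x) \<le> t * u x" if t: "0 < t" for t x
    proof -
      have "u (t *\<^sub>R x) / t \<le> u x"
      proof (rule ge)
        fix q assume "q \<in> K"
        then show "u (t *\<^sub>R x) / t \<le> q x"
          using le[of q "t *\<^sub>R x"] sublinear_scale[OF sub, of q t x] t by (simp add: field_simps)
      qed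
      then show ?thesis using t by (simp add: field_simps)
    qed
    ultimately have "sublinear u" by (intro sublinearI)
    moreover have "u x \<le> p x" for x
    proof -
      obtain q where "q \<in> K" using False by blast
      then show ?thesis using le[of q x] KQ[of q] by (auto simp: Q_def intro: order_trans)
    qed
    ultimately have "u \<in> Q" by (simp add: Q_def)
    then show ?thesis using le by (auto simp: R_def)
  qed
  ultimately obtain m where m: "m \<in> Q" "\<And>q. q \<in> Q \<Longrightarrow> R m q \<Longrightarrow> q = m"
    using predicate_Zorn[of Q R] by blast
  have mp: "sublinear m" "\<And>x. m x \<le> p x" using m(1) by (auto simp: Q_def)
  have "linear m"
  proof (rule minimal_sublinear_linear[OF mp(1)])
    fix s assume s: "sublinear s" "\<And>x. s x \<le> m x"
    have "s x \<le> p x" for x using s(2)[of x] mp(2)[of x] by simp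
    with s show "s = m" by (intro m(2)) (auto simp: Q_def R_def)
  qed
  with mp(2) that show thesis by blast
qed

text \<open>The Hahn--Banach theorem for normed spaces: constraints \<open>r \<le> f c\<close> that form a convex cone can be
  met by a functional of norm at most one as soon as each of them is compatible with that bound.\<close>

lemma norm_dominated_functional_on_cone:
  fixes C :: "('a::real_normed_vector \<times> real) set"
  assumes C: "convex_cone_pairs C" and dom: "\<And>c r. (c, r) \<in> C \<Longrightarrow> r \<le> norm c"
  obtains f :: "'a \<Rightarrow>\<^sub>L real"
  where "\<And>x. \<bar>blinfun_apply f x\<bar> \<le> norm x" "\<And>c r. (c, r) \<in> C \<Longrightarrow> r \<le> blinfun_apply f c"
proof -
  obtain q where q: "sublinear q" "\<And>x. q x \<le> norm x"
    and qC: "\<And>c r. (c, r) \<in> C \<Longrightarrow> q (- c) \<le> - r"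
    using sublinear_cone_reduction[OF sublinear_norm C dom] by blast
  obtain f where f: "linear f" "\<And>x. f x \<le> q x"
    using sublinear_dominates_linear[OF q(1)] by blast
  have neg: "f (- x) = - f x" for x using f(1) by (rule linear_neg)
  have le: "\<bar>f x\<bar> \<le> norm x" for x
    using f(2)[of x] q(2)[of x] f(2)[of "- x"] q(2)[of "- x"] by (simp add: neg)
  have "bounded_linear f"
    using f(1) le by (intro bounded_linear_intro[of _ 1]) (auto simp: linear_add linear_scale)
  then have app: "blinfun_apply (Blinfun f) = f" by (rule bounded_linear_Blinfun_apply)
  show thesis
  proof (rule that)
    show "r \<le> blinfun_apply (Blinfun f) c" if "(c, r) \<in> C" for c r
      using f(2)[of "- c"] qC[OF that] by (simp add: app neg)
  qed (simp add: app le)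
qed

text \<open>Birkhoff--James orthogonality in a real normed space; it is not symmetric in general.\<close>

definition birkhoff_orthogonal :: "'a::real_normed_vector \<Rightarrow> 'a \<Rightarrow> bool" where
  "birkhoff_orthogonal z a \<longleftrightarrow> (\<forall>t. norm z \<le> norm (z + t *\<^sub>R a))"

text \<open>Orthogonality says exactly that the functional \<open>s z + t a \<mapsto> s \<parallel>z\<parallel>\<close> has norm at most one. The cone
  contains \<open>(\<plusminus>a, 0)\<close>, which forces \<open>f a = 0\<close>.\<close>

lemma birkhoff_orthogonal_support_functional:
  fixes z a :: "'a::real_normed_vector"
  assumes "birkhoff_orthogonal z a"
  obtains f :: "'a \<Rightarrow>\<^sub>L real"
  where "\<And>x. \<bar>blinfun_apply f x\<bar> \<le> norm x" "blinfun_apply f z = norm z" "blinfun_apply f a = 0"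
proof -
  define C where "C = {(s *\<^sub>R z + t *\<^sub>R a, s * norm z) | s t. 0 \<le> s}"
  have mem: "(s *\<^sub>R z + t *\<^sub>R a, s * norm z) \<in> C" if "0 \<le> s" for s t
    using that by (auto simp: C_def)
  have "u + v \<in> C" if uv: "u \<in> C" "v \<in> C" for u v
  proof -
    obtain s t s' t' where "0 \<le> s" "u = (s *\<^sub>R z + t *\<^sub>R a, s * norm z)"
      "0 \<le> s'" "v = (s' *\<^sub>R z + t' *\<^sub>R a, s' * norm z)"
      using uv by (auto simp: C_def)
    then show ?thesis using mem[of "s + s'" "t + t'"] by (simp add: algebra_simps)
  qed
  moreover have "k *\<^sub>R u \<in> C" if k: "k > 0" and u: "u \<in> C" for k u
  proof -
    obtain s t where "0 \<le> s" "u = (s *\<^sub>R z + t *\<^sub>R a, s * norm z)"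
      using u by (auto simp: C_def)
    then show ?thesis using mem[of "k * s" "k * t"] k by (simp add: algebra_simps)
  qed
  moreover have "0 \<in> C" using mem[of 0 0] by (simp add: zero_prod_def)
  ultimately have cone: "convex_cone_pairs C" by (simp add: convex_cone_pairs_def)
  have dom: "r \<le> norm c" if cr: "(c, r) \<in> C" for c r
  proof -
    obtain s t where st: "0 \<le> s" "c = s *\<^sub>R z + t *\<^sub>R a" "r = s * norm z"
      using cr by (auto simp: C_def)
    show ?thesis
    proof (cases "s = 0")
      case False
      have "s * norm z \<le> s * norm (z + (t / s) *\<^sub>R a)"
        using assms st(1) by (intro mult_left_mono) (auto simp: birkhoff_orthogonal_def)
      also have "\<dots> = norm (s *\<^sub>R (z + (t / s) *\<^sub>R a))" using st(1) by simp
      also have "s *\<^sub>R (z + (t / s) *\<^sub>R a) = c"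
        using False st(2) by (simp add: scaleR_add_right)
      finally show ?thesis using st(3) by simp
    qed (use st in simp)
  qed
  obtain f :: "'a \<Rightarrow>\<^sub>L real" where f: "\<And>x. \<bar>blinfun_apply f x\<bar> \<le> norm x"
    and fC: "\<And>c r. (c, r) \<in> C \<Longrightarrow> r \<le> blinfun_apply f c"
    using norm_dominated_functional_on_cone[OF cone dom] by blast
  have "norm z \<le> blinfun_apply f z" using fC[OF mem[of 1 0]] by simp
  then have "blinfun_apply f z = norm z" using f[of z] by linarith
  moreover have "blinfun_apply f a = 0"
    using fC[OF mem[of 0 1]] fC[OF mem[of 0 "-1"]] by (simp add: blinfun.minus_right)
  ultimately show thesis using f that by blast
qed

lemma norming_functional:
  fixes z :: "'a::real_normed_vector"
  obtains f :: "'a \<Rightarrow>\<^sub>L real"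
  where "\<And>x. \<bar>blinfun_apply f x\<bar> \<le> norm x" "blinfun_apply f z = norm z"
  using birkhoff_orthogonal_support_functional[of z 0] by (auto simp: birkhoff_orthogonal_def)

section \<open>Reflexive spaces: bounded operators map the closed unit ball to a closed set\<close>

text \<open>For \<open>z\<close> in the closure, \<open>\<bar>g z\<bar> \<le> \<parallel>g \<circ> B\<parallel>\<close> for every functional \<open>g\<close>, so some \<open>F\<close> in the unit
  ball of the bidual satisfies \<open>F (g \<circ> B) = g z\<close>. By reflexivity \<open>F\<close> is evaluation at some \<open>x\<close>, and
  \<open>g (B x) = g z\<close> for all \<open>g\<close> means \<open>B x = z\<close>.\<close>

lemma reflexive_image_cball_closed:
  fixes B :: "'a::real_normed_vector \<Rightarrow>\<^sub>L 'b::real_normed_vector"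
  assumes refl: "reflexive_space TYPE('a)"
    and z: "z \<in> closure (blinfun_apply B ` cball 0 1)"
  shows "z \<in> blinfun_apply B ` cball 0 1"
proof -
  define C where "C = range (\<lambda>g :: 'b \<Rightarrow>\<^sub>L real. (g o\<^sub>L B, blinfun_apply g z))"
  have mem: "(g o\<^sub>L B, blinfun_apply g z) \<in> C" for g :: "'b \<Rightarrow>\<^sub>L real"
    by (simp add: C_def)
  have "u + v \<in> C" if uv: "u \<in> C" "v \<in> C" for u v
  proof -
    obtain g h :: "'b \<Rightarrow>\<^sub>L real" where "u = (g o\<^sub>L B, blinfun_apply g z)" "v = (h o\<^sub>L B, blinfun_apply h z)"
      using uv by (auto simp: C_def)
    moreover have "(g + h) o\<^sub>L B = (g o\<^sub>L B) + (h o\<^sub>L B)"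
      by (rule blinfun_eqI) (simp add: blinfun.add_left)
    ultimately show ?thesis using mem[of "g + h"] by (simp add: blinfun.add_left)
  qed
  moreover have "k *\<^sub>R u \<in> C" if u: "u \<in> C" for k u
  proof -
    obtain g :: "'b \<Rightarrow>\<^sub>L real" where "u = (g o\<^sub>L B, blinfun_apply g z)"
      using u by (auto simp: C_def)
    moreover have "(k *\<^sub>R g) o\<^sub>L B = k *\<^sub>R (g o\<^sub>L B)"
      by (rule blinfun_eqI) (simp add: blinfun.scaleR_left)
    ultimately show ?thesis using mem[of "k *\<^sub>R g"] by (simp add: blinfun.scaleR_left)
  qed
  moreover have "(0 :: ('a \<Rightarrow>\<^sub>L real) \<times> real) \<in> C"
  proof -
    have "(0 :: 'b \<Rightarrow>\<^sub>L real) o\<^sub>L B = 0" by (rule blinfun_eqI) simp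
    then show ?thesis using mem[of 0] by (simp add: zero_prod_def)
  qed
  ultimately have cone: "convex_cone_pairs C" by (simp add: convex_cone_pairs_def)
  have dom: "r \<le> norm c" if cr: "(c, r) \<in> C" for c r
  proof -
    obtain g :: "'b \<Rightarrow>\<^sub>L real" where g: "c = g o\<^sub>L B" "r = blinfun_apply g z"
      using cr by (auto simp: C_def)
    have "blinfun_apply B ` cball 0 1 \<subseteq> {y. blinfun_apply g y \<le> norm (g o\<^sub>L B)}"
    proof safe
      fix x :: 'a assume "x \<in> cball 0 1"
      then have "norm (g o\<^sub>L B) * norm x \<le> norm (g o\<^sub>L B) * 1"
        by (intro mult_left_mono) auto
      then show "blinfun_apply g (blinfun_apply B x) \<le> norm (g o\<^sub>L B)"
        using norm_blinfun[of "g o\<^sub>L B" x] by simp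
    qed
    moreover have "closed {y. blinfun_apply g y \<le> norm (g o\<^sub>L B)}"
      by (intro closed_Collect_le continuous_intros)
    ultimately have "z \<in> {y. blinfun_apply g y \<le> norm (g o\<^sub>L B)}"
      using z closure_minimal by blast
    then show ?thesis by (simp add: g)
  qed
  obtain F :: "('a \<Rightarrow>\<^sub>L real) \<Rightarrow>\<^sub>L real" where F: "\<And>f. \<bar>blinfun_apply F f\<bar> \<le> norm f"
    and FC: "\<And>c r. (c, r) \<in> C \<Longrightarrow> r \<le> blinfun_apply F c"
    using norm_dominated_functional_on_cone[OF cone dom] by blast
  obtain x :: 'a where x: "\<And>f. blinfun_apply F f = blinfun_apply f x"
    using refl unfolding reflexive_space_def by blast
  have "norm x \<le> 1"
  proof -
    obtain f :: "'a \<Rightarrow>\<^sub>L real" where f: "\<And>y. \<bar>blinfun_apply f y\<bar> \<le> norm y" "blinfun_apply f x = norm x"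
      using norming_functional[of x] by blast
    have "norm f \<le> 1" using f(1) by (intro norm_blinfun_bound) auto
    then show ?thesis using F[of f] x[of f] f(2) by simp
  qed
  moreover have "blinfun_apply B x = z"
  proof -
    obtain g :: "'b \<Rightarrow>\<^sub>L real"
      where g: "blinfun_apply g (z - blinfun_apply B x) = norm (z - blinfun_apply B x)"
      using norming_functional[of "z - blinfun_apply B x"] by blast
    have "blinfun_apply g z \<le> blinfun_apply g (blinfun_apply B x)"
      using FC[OF mem[of g]] x[of "g o\<^sub>L B"] by simp
    then have "norm (z - blinfun_apply B x) \<le> 0" using g unfolding blinfun.diff_right by linarith
    then show ?thesis by simp
  qed
  ultimately show ?thesis by (intro image_eqI[of _ _ x]) auto
qed

lemma compact_operators_joint_subsequence:
  fixes T A :: "'a::real_normed_vector \<Rightarrow>\<^sub>L 'b::real_normed_vector"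
  assumes refl: "reflexive_space TYPE('a)"
    and T: "T \<in> compact_operators" and A: "A \<in> compact_operators"
    and X: "\<And>n. X n \<in> cball (0::'a) 1"
  obtains x :: 'a and r :: "nat \<Rightarrow> nat" where "x \<in> cball 0 1" "strict_mono r"
    "(\<lambda>n. blinfun_apply T (X (r n))) \<longlonglongrightarrow> blinfun_apply T x"
    "(\<lambda>n. blinfun_apply A (X (r n))) \<longlonglongrightarrow> blinfun_apply A x"
proof -
  define B where "B = Blinfun (\<lambda>x. (blinfun_apply T x, blinfun_apply A x))"
  have B: "blinfun_apply B x = (blinfun_apply T x, blinfun_apply A x)" for x
    unfolding B_def
    by (subst bounded_linear_Blinfun_apply)
       (auto intro: bounded_linear_Pair blinfun.bounded_linear_right)
  define K where "K = closure (blinfun_apply T ` cball 0 1) \<times> closure (blinfun_apply A ` cball 0 1)"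
  have "compact K" using T A by (auto simp: K_def compact_operators_def intro: compact_Times)
  moreover have "\<forall>n. blinfun_apply B (X n) \<in> K"
    using X closure_subset by (force simp: K_def B)
  ultimately obtain z r where r: "strict_mono r" and lim: "((\<lambda>n. blinfun_apply B (X n)) \<circ> r) \<longlonglongrightarrow> z"
    unfolding compact_def by metis
  have "z \<in> closure (blinfun_apply B ` cball 0 1)"
    unfolding closure_sequential
    using X lim by (intro exI[of _ "(\<lambda>n. blinfun_apply B (X n)) \<circ> r"]) auto
  from reflexive_image_cball_closed[OF refl this]
  obtain x where x: "x \<in> cball 0 1" "z = blinfun_apply B x" by blast
  have "(\<lambda>n. (blinfun_apply T (X (r n)), blinfun_apply A (X (r n)))) \<longlonglongrightarrow>
      (blinfun_apply T x, blinfun_apply A x)"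
    using lim by (simp add: x(2) B o_def)
  from tendsto_fst[OF this] tendsto_snd[OF this] show thesis
    using that[OF x(1) r] by simp
qed

section \<open>A point of norm attainment with orthogonal images\<close>

text \<open>The norm does not drop below its value at \<open>z\<close> along the ray from \<open>z\<close> in direction \<open>a\<close>; by convexity
  this is the same as being nondecreasing along that ray.\<close>

definition ray_nondecreasing :: "'a::real_normed_vector \<Rightarrow> 'a \<Rightarrow> bool" where
  "ray_nondecreasing z a \<longleftrightarrow> (\<forall>t\<ge>0. norm z \<le> norm (z + t *\<^sub>R a))"

lemma norm_ray_convex:
  fixes z a :: "'a::real_normed_vector"
  assumes "0 \<le> s" "0 \<le> t" "s + t > 0"
  shows "norm z \<le> t / (s + t) * norm (z - s *\<^sub>R a) + s / (s + t) * norm (z + t *\<^sub>R a)"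
proof -
  have "z = (t / (s + t)) *\<^sub>R (z - s *\<^sub>R a) + (s / (s + t)) *\<^sub>R (z + t *\<^sub>R a)"
  proof -
    have "(t / (s + t)) *\<^sub>R (z - s *\<^sub>R a) + (s / (s + t)) *\<^sub>R (z + t *\<^sub>R a)
        = (t / (s + t) + s / (s + t)) *\<^sub>R z + (s / (s + t) * t - t / (s + t) * s) *\<^sub>R a"
      by (simp add: algebra_simps)
    also have "t / (s + t) + s / (s + t) = 1"
      using assms by (simp add: add_divide_distrib[symmetric] add.commute)
    finally show ?thesis by simp
  qed
  then have "norm z \<le> norm ((t / (s + t)) *\<^sub>R (z - s *\<^sub>R a)) + norm ((s / (s + t)) *\<^sub>R (z + t *\<^sub>R a))"
    using norm_triangle_ineq by metis
  then show ?thesis using assms by simp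
qed

lemma ray_nondecreasing_dichotomy:
  "ray_nondecreasing z a \<or> ray_nondecreasing z (- a)"
proof (rule ccontr)
  assume "\<not> ?thesis"
  then obtain s t where s: "0 \<le> s" "norm (z - s *\<^sub>R a) < norm z"
    and t: "0 \<le> t" "norm (z + t *\<^sub>R a) < norm z"
    by (auto simp: ray_nondecreasing_def not_le)
  have pos: "s > 0" "t > 0" using s t by (auto simp: less_le)
  have "t / (s + t) * norm (z - s *\<^sub>R a) + s / (s + t) * norm (z + t *\<^sub>R a)
      < t / (s + t) * norm z + s / (s + t) * norm z"
    using pos s t by (intro add_strict_mono mult_strict_left_mono) auto
  also have "\<dots> = norm z"
    using pos by (simp add: distrib_right[symmetric] add_divide_distrib[symmetric] add.commute)
  finally show False using norm_ray_convex[of s t z a] pos by simp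
qed

lemma ray_nondecreasing_uminus_both:
  "ray_nondecreasing (- z) (- a) \<longleftrightarrow> ray_nondecreasing z a"
proof -
  have "norm (- z + t *\<^sub>R (- a)) = norm (z + t *\<^sub>R a)" for t
    using norm_minus_cancel[of "z + t *\<^sub>R a"] by simp
  then show ?thesis by (simp add: ray_nondecreasing_def)
qed

lemma birkhoff_orthogonal_iff_rays:
  "birkhoff_orthogonal z a \<longleftrightarrow> ray_nondecreasing z a \<and> ray_nondecreasing z (- a)"
proof
  assume R: "ray_nondecreasing z a \<and> ray_nondecreasing z (- a)"
  have "norm z \<le> norm (z + t *\<^sub>R a)" for t
    using R by (cases "0 \<le> t") (auto simp: ray_nondecreasing_def dest!: spec[of _ "- t"])
  then show "birkhoff_orthogonal z a" by (simp add: birkhoff_orthogonal_def)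
next
  assume B: "birkhoff_orthogonal z a"
  have "norm z \<le> norm (z + t *\<^sub>R (- a))" for t
    using B[unfolded birkhoff_orthogonal_def, rule_format, of "- t"] by simp
  with B show "ray_nondecreasing z a \<and> ray_nondecreasing z (- a)"
    by (simp add: ray_nondecreasing_def birkhoff_orthogonal_def)
qed

lemma closed_ray_nondecreasing:
  fixes S A :: "'a::real_normed_vector \<Rightarrow>\<^sub>L 'b::real_normed_vector"
  shows "closed {x. ray_nondecreasing (blinfun_apply S x) (blinfun_apply A x)}"
  unfolding ray_nondecreasing_def
  by (intro closed_Collect_all closed_Collect_imp closed_Collect_le continuous_intros) auto

lemma near_norming_vector:
  fixes S :: "'a::real_normed_vector \<Rightarrow>\<^sub>L 'b::real_normed_vector"
  assumes "e > 0"
  obtains x where "x \<in> cball 0 1" "norm S - e \<le> norm (blinfun_apply S x)"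
proof -
  have "\<exists>x \<in> cball 0 1. norm S - e \<le> norm (blinfun_apply S x)"
  proof (rule ccontr)
    assume "\<not> ?thesis"
    then have lt: "norm (blinfun_apply S x) < norm S - e" if "norm x \<le> 1" for x
      using that by force
    have "0 \<le> norm S - e" using lt[of 0] by simp
    moreover have "norm (blinfun_apply S x) \<le> (norm S - e) * norm x" for x
    proof (cases "x = 0")
      case False
      then show ?thesis
        using lt[of "x /\<^sub>R norm x"] by (simp add: blinfun.scaleR_right field_simps)
    qed simp
    ultimately have "norm S \<le> norm S - e" by (rule norm_blinfun_bound)
    with assms show False by simp
  qed
  with that show thesis by blast
qed

text \<open>The hypothesis \<open>seq\<close> is stated for \<open>S\<close> and \<open>A\<close> jointly so that it also applies to \<open>- A\<close>.\<close>

lemma norm_attained_with_ray_nondecreasing: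
  fixes S A :: "'a::real_normed_vector \<Rightarrow>\<^sub>L 'b::real_normed_vector"
  assumes seq: "\<And>X. (\<And>n::nat. X n \<in> cball (0::'a) 1) \<Longrightarrow>
      \<exists>x r. x \<in> cball 0 1 \<and> strict_mono (r :: nat \<Rightarrow> nat) \<and>
        (\<lambda>n. blinfun_apply S (X (r n))) \<longlonglongrightarrow> blinfun_apply S x \<and>
        (\<lambda>n. blinfun_apply A (X (r n))) \<longlonglongrightarrow> blinfun_apply A x"
    and nz: "S \<noteq> 0"
    and ray: "ray_nondecreasing S A"
  shows "\<exists>x \<in> norm_attainment_set S. ray_nondecreasing (blinfun_apply S x) (blinfun_apply A x)"
proof -
  define e where "e n = inverse (real (Suc n))" for n
  have e: "e n > 0" for n by (simp add: e_def)
  have e0: "e \<longlonglongrightarrow> 0" unfolding e_def by (rule LIMSEQ_inverse_real_of_nat)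
  \<comment> \<open>The defect must be of smaller order than \<open>e n\<close>: convexity magnifies it by the factor \<open>t / e n\<close>.\<close>
  have "\<exists>x. x \<in> cball 0 1 \<and>
      norm (S + e n *\<^sub>R A) - e n * e n \<le> norm (blinfun_apply (S + e n *\<^sub>R A) x)" for n
    using near_norming_vector[of "e n * e n" "S + e n *\<^sub>R A"] e[of n] by auto
  then obtain X where X: "\<And>n. X n \<in> cball 0 1"
    and Xn: "\<And>n. norm (S + e n *\<^sub>R A) - e n * e n \<le> norm (blinfun_apply (S + e n *\<^sub>R A) (X n))"
    by metis
  have key: "norm S - e n * e n \<le> norm (blinfun_apply S (X n) + e n *\<^sub>R blinfun_apply A (X n))" for n
  proof -
    have "norm S \<le> norm (S + e n *\<^sub>R A)"
      using ray less_imp_le[OF e[of n]] by (simp add: ray_nondecreasing_def)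
    with Xn[of n] show ?thesis by (simp add: blinfun.add_left blinfun.scaleR_left)
  qed
  obtain x r where x: "x \<in> cball 0 1" and r: "strict_mono (r :: nat \<Rightarrow> nat)"
    and limS: "(\<lambda>n. blinfun_apply S (X (r n))) \<longlonglongrightarrow> blinfun_apply S x"
    and limA: "(\<lambda>n. blinfun_apply A (X (r n))) \<longlonglongrightarrow> blinfun_apply A x"
    using seq[of X, OF X] by blast
  have er: "(\<lambda>n. e (r n)) \<longlonglongrightarrow> 0"
    using LIMSEQ_subseq_LIMSEQ[OF e0 r] by (simp add: o_def)
  have bound: "norm (blinfun_apply S y) \<le> norm S" if "y \<in> cball 0 1" for y
  proof -
    have "norm S * norm y \<le> norm S * 1" using that by (intro mult_left_mono) auto
    with norm_blinfun[of S y] show ?thesis by simp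
  qed
  have "norm S - 0 * 0 \<le> norm (blinfun_apply S x + 0 *\<^sub>R blinfun_apply A x)"
  proof (rule LIMSEQ_le)
    show "(\<lambda>n. norm S - e (r n) * e (r n)) \<longlonglongrightarrow> norm S - 0 * 0"
      by (intro tendsto_intros er)
    show "(\<lambda>n. norm (blinfun_apply S (X (r n)) + e (r n) *\<^sub>R blinfun_apply A (X (r n))))
        \<longlonglongrightarrow> norm (blinfun_apply S x + 0 *\<^sub>R blinfun_apply A x)"
      by (intro tendsto_intros er limS limA)
  qed (use key in blast)
  then have Sx: "norm (blinfun_apply S x) = norm S" using bound[OF x] by simp
  have "norm x = 1"
  proof -
    have "norm S * 1 \<le> norm S * norm x" using norm_blinfun[of S x] Sx by simp
    then have "1 \<le> norm x" using nz by (simp only: mult_le_cancel_left) auto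
    then show ?thesis using x by simp
  qed
  moreover have "norm (blinfun_apply S x) \<le> norm (blinfun_apply S x + t *\<^sub>R blinfun_apply A x)"
    if t: "0 \<le> t" for t
  proof (cases "t = 0")
    case False
    with t have t: "t > 0" by simp
    have "norm S - 0 * t \<le> norm (blinfun_apply S x + t *\<^sub>R blinfun_apply A x)"
    proof (rule LIMSEQ_le)
      show "(\<lambda>n. norm S - e (r n) * t) \<longlonglongrightarrow> norm S - 0 * t"
        by (intro tendsto_intros er)
      show "(\<lambda>n. norm (blinfun_apply S (X (r n)) + t *\<^sub>R blinfun_apply A (X (r n))))
          \<longlonglongrightarrow> norm (blinfun_apply S x + t *\<^sub>R blinfun_apply A x)"
        by (intro tendsto_intros limS limA)
      have "eventually (\<lambda>n. e (r n) < t) sequentially"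
        using order_tendstoD(2)[OF er t] .
      then obtain N where N: "\<And>n. n \<ge> N \<Longrightarrow> e (r n) < t"
        by (auto simp: eventually_sequentially)
      have "norm S - e (r n) * t \<le> norm (blinfun_apply S (X (r n)) + t *\<^sub>R blinfun_apply A (X (r n)))"
        if n: "n \<ge> N" for n
      proof -
        define d where "d = e (r n)"
        define u where "u = blinfun_apply S (X (r n))"
        define a where "a = blinfun_apply A (X (r n))"
        have d: "0 < d" "d < t" using e[of "r n"] N[OF n] by (auto simp: d_def)
        \<comment> \<open>\<open>u + d a\<close> lies between \<open>u\<close> and \<open>u + t a\<close>.\<close>
        have "norm (u + d *\<^sub>R a)
            \<le> (t - d) / t * norm u + d / t * norm (u + t *\<^sub>R a)"
          using norm_ray_convex[of d "t - d" "u + d *\<^sub>R a" a] d by (simp add: algebra_simps)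
        moreover have "(t - d) / t * norm u \<le> (t - d) / t * norm S"
          using bound[OF X, of "r n"] d by (intro mult_left_mono) (auto simp: u_def)
        moreover have "norm S - d * d \<le> norm (u + d *\<^sub>R a)"
          using key[of "r n"] by (simp add: d_def u_def a_def)
        ultimately have "norm S - d * d \<le> (t - d) / t * norm S + d / t * norm (u + t *\<^sub>R a)"
          by linarith
        then have "d * (norm S - d * t) \<le> d * norm (u + t *\<^sub>R a)"
          using d by (simp add: field_simps)
        then show ?thesis using d by (simp add: d_def u_def a_def)
      qed
      then show "\<exists>N. \<forall>n\<ge>N. norm S - e (r n) * t
          \<le> norm (blinfun_apply S (X (r n)) + t *\<^sub>R blinfun_apply A (X (r n)))" by blast
    qed
    then show ?thesis using Sx by simp
  qed simp
  ultimately show ?thesis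
    using Sx by (intro bexI[of _ x]) (auto simp: ray_nondecreasing_def norm_attainment_set_def)
qed

text \<open>Since only \<open>D \<union> - D\<close> is the norm attainment set, points of it are moved into \<open>D\<close> by a change of
  sign, which preserves both ray conditions.\<close>

lemma norm_attained_with_birkhoff_orthogonal:
  fixes T A :: "'a::real_normed_vector \<Rightarrow>\<^sub>L 'b::real_normed_vector" and c :: real
  defines "S \<equiv> T - c *\<^sub>R A"
  assumes refl: "reflexive_space TYPE('a)"
    and T: "T \<in> compact_operators" and A: "A \<in> compact_operators"
    and nz: "S \<noteq> 0" and orth: "birkhoff_orthogonal S A"
    and D: "connected D" and MD: "norm_attainment_set S = D \<union> uminus ` D"
  shows "\<exists>x \<in> norm_attainment_set S. birkhoff_orthogonal (blinfun_apply S x) (blinfun_apply A x)"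
proof -
  have seq: "\<exists>x r. x \<in> cball 0 1 \<and> strict_mono (r :: nat \<Rightarrow> nat) \<and>
        (\<lambda>n. blinfun_apply S (X (r n))) \<longlonglongrightarrow> blinfun_apply S x \<and>
        (\<lambda>n. blinfun_apply A (X (r n))) \<longlonglongrightarrow> blinfun_apply A x"
    if X: "\<And>n::nat. X n \<in> cball (0::'a) 1" for X
  proof -
    obtain x :: 'a and r :: "nat \<Rightarrow> nat" where xr: "x \<in> cball 0 1" "strict_mono r"
      and lim: "(\<lambda>n. blinfun_apply T (X (r n))) \<longlonglongrightarrow> blinfun_apply T x"
        "(\<lambda>n. blinfun_apply A (X (r n))) \<longlonglongrightarrow> blinfun_apply A x"
      using compact_operators_joint_subsequence[OF refl T A, of X] X by blast
    have "(\<lambda>n. blinfun_apply T (X (r n)) - c *\<^sub>R blinfun_apply A (X (r n)))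
        \<longlonglongrightarrow> blinfun_apply T x - c *\<^sub>R blinfun_apply A x"
      by (intro tendsto_intros lim)
    then show ?thesis using xr lim
      by (intro exI[of _ x] exI[of _ r]) (simp add: S_def blinfun.diff_left blinfun.scaleR_left)
  qed
  define P where "P a = {x. ray_nondecreasing (blinfun_apply S x) (blinfun_apply a x)}" for a
  have in_D: "D \<inter> P a \<noteq> {}" if M: "x \<in> norm_attainment_set S" "x \<in> P a" for x a
  proof -
    have "- x \<in> P a"
      using M(2) ray_nondecreasing_uminus_both[of "blinfun_apply S x" "blinfun_apply a x"]
      by (simp add: P_def blinfun.minus_right)
    moreover have "x \<in> D \<or> - x \<in> D" using M(1) MD by auto
    ultimately show ?thesis using M(2) by blast
  qed
  have rays: "ray_nondecreasing S A" "ray_nondecreasing S (- A)"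
    using orth by (auto simp: birkhoff_orthogonal_iff_rays)
  have "D \<inter> P A \<noteq> {}"
    using norm_attained_with_ray_nondecreasing[OF seq nz rays(1)] in_D[of _ A] by (auto simp: P_def)
  moreover have "D \<inter> P (- A) \<noteq> {}"
  proof -
    have "\<exists>x r. x \<in> cball 0 1 \<and> strict_mono (r :: nat \<Rightarrow> nat) \<and>
        (\<lambda>n. blinfun_apply S (X (r n))) \<longlonglongrightarrow> blinfun_apply S x \<and>
        (\<lambda>n. blinfun_apply (- A) (X (r n))) \<longlonglongrightarrow> blinfun_apply (- A) x"
      if X: "\<And>n::nat. X n \<in> cball (0::'a) 1" for X
      using seq[of X, OF X] unfolding blinfun.minus_left by (metis tendsto_minus)
    from norm_attained_with_ray_nondecreasing[OF this nz rays(2)]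
    show ?thesis using in_D[of _ "- A"] by (auto simp: P_def)
  qed
  moreover have "D \<subseteq> P A \<union> P (- A)"
    using ray_nondecreasing_dichotomy by (auto simp: P_def blinfun.minus_left)
  moreover have "closed (P A)" "closed (P (- A))"
    unfolding P_def by (rule closed_ray_nondecreasing)+
  ultimately have "P A \<inter> P (- A) \<inter> D \<noteq> {}"
    using D unfolding connected_closed by blast
  then obtain x where "x \<in> D" "x \<in> P A" "x \<in> P (- A)" by blast
  then show ?thesis
    using MD by (intro bexI[of _ x]) (auto simp: P_def birkhoff_orthogonal_iff_rays blinfun.minus_left)
qed

section \<open>Semi-inner products with a prescribed support functional\<close>

text \<open>A choice of support functionals \<open>G y\<close> at the unit vectors gives a semi-inner product
  \<open>[x, y] = \<parallel>y\<parallel> G (y / \<parallel>y\<parallel>) x\<close> provided that \<open>G (- y) = - G y\<close>. Replacing \<open>G\<close> by its odd part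
  achieves this, and \<open>G\<close> is set to \<open>\<plusminus>f\<close> at \<open>\<plusminus>w\<close> so that the odd part at \<open>w\<close> is still \<open>f\<close>.\<close>

lemma semi_inner_product_with_support_functional:
  fixes w :: "'a::real_normed_vector" and f :: "'a \<Rightarrow>\<^sub>L real"
  assumes w: "norm w = 1" and f: "\<And>x. \<bar>blinfun_apply f x\<bar> \<le> norm x" and fw: "blinfun_apply f w = 1"
  obtains p where "semi_inner_product p" "\<And>x. p x w = blinfun_apply f x"
proof -
  have "\<exists>g :: 'a \<Rightarrow>\<^sub>L real. (\<forall>x. \<bar>blinfun_apply g x\<bar> \<le> norm x) \<and> blinfun_apply g y = norm y" for y
    using norming_functional[of y] by metis
  then obtain G0 :: "'a \<Rightarrow> 'a \<Rightarrow>\<^sub>L real" where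
    G0: "\<And>y x. \<bar>blinfun_apply (G0 y) x\<bar> \<le> norm x" "\<And>y. blinfun_apply (G0 y) y = norm y"
    by metis
  define G where "G y = (if y = w then f else if y = - w then - f else G0 y)" for y
  have G: "\<bar>blinfun_apply (G y) x\<bar> \<le> norm x" "blinfun_apply (G y) y = norm y" for x y
    using f G0 fw w by (auto simp: G_def blinfun.minus_left blinfun.minus_right)
  define J where "J x y = (blinfun_apply (G y) x - blinfun_apply (G (- y)) x) / 2" for x y
  have J_odd: "J x (- y) = - J x y" for x y by (simp add: J_def field_simps)
  have J_le: "\<bar>J x y\<bar> \<le> norm x" for x y
    using G(1)[of y x] G(1)[of "- y" x] unfolding J_def abs_le_iff by (simp add: field_simps)
  have J_self: "J y y = norm y" for y
    using G(2)[of y] G(2)[of "- y"] by (simp add: J_def blinfun.minus_right)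
  have J_lin: "J (a *\<^sub>R x + b *\<^sub>R y) z = a * J x z + b * J y z" for a b x y z
    by (simp add: J_def blinfun.add_right blinfun.scaleR_right field_simps)
  define p where "p x y = norm y * J x (sgn y)" for x y
  have p_self: "p x x = (norm x)\<^sup>2" for x
  proof (cases "x = 0")
    case False
    have "J x (sgn x) = norm x * J (sgn x) (sgn x)"
      using J_lin[of "norm x" "sgn x" 0 0 "sgn x"] False by (simp add: sgn_div_norm)
    then show ?thesis
      using False by (simp add: p_def J_self norm_sgn power2_eq_square)
  qed (simp add: p_def)
  have "semi_inner_product p"
    unfolding semi_inner_product_def
  proof (intro conjI allI impI)
    show "p (a *\<^sub>R x + b *\<^sub>R y) z = a * p x z + b * p y z" for a b x y z
      by (simp add: p_def J_lin algebra_simps)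
    show "0 < p x x" if "x \<noteq> 0" for x using that by (simp add: p_self)
    show "\<bar>p x y\<bar>\<^sup>2 \<le> p x x * p y y" for x y
    proof -
      have "\<bar>p x y\<bar> \<le> norm y * norm x"
        unfolding p_def abs_mult using J_le[of x "sgn y"] by (simp add: mult_left_mono)
      then have "\<bar>p x y\<bar>\<^sup>2 \<le> (norm y * norm x)\<^sup>2" by (intro power_mono) auto
      then show ?thesis by (simp add: p_self power_mult_distrib mult.commute)
    qed
    show "p x (a *\<^sub>R y) = a * p x y" for a x y
      by (cases a "0::real" rule: linorder_cases) (auto simp: p_def sgn_scaleR J_odd)
    show "p x x = (norm x)\<^sup>2" for x by (rule p_self)
  qed
  moreover have "p x w = blinfun_apply f x" for x
  proof -
    have "w \<noteq> - w"
    proof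
      assume "w = - w"
      then have "blinfun_apply f w = - blinfun_apply f w" by (metis blinfun.minus_right)
      with fw show False by simp
    qed
    then have "G w = f" "G (- w) = - f" by (auto simp: G_def)
    then show ?thesis using w by (simp add: p_def J_def sgn_div_norm blinfun.minus_left)
  qed
  ultimately show thesis using that by blast
qed

lemma semi_inner_product_cauchy_schwarz:
  fixes p :: "'a::real_normed_vector \<Rightarrow> 'a \<Rightarrow> real"
  assumes "semi_inner_product p"
  shows "\<bar>p x y\<bar> \<le> norm x * norm y"
proof -
  have "\<bar>p x y\<bar>\<^sup>2 \<le> (norm x * norm y)\<^sup>2"
    using assms unfolding semi_inner_product_def by (metis power_mult_distrib)
  then show ?thesis by (rule power2_le_imp_le) simp
qed

section \<open>The distance formula\<close>

lemma infdist_best_approximation: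
  fixes x :: "'a::real_normed_vector"
  assumes "best_approximation x V y"
  shows "infdist x V = norm (x - y)"
proof (rule order_antisym)
  show "infdist x V \<le> norm (x - y)"
    using assms infdist_le[of y V x] by (simp add: best_approximation_def dist_norm)
  have "V \<noteq> {}" using assms by (auto simp: best_approximation_def)
  then show "norm (x - y) \<le> infdist x V"
    using assms unfolding infdist_notempty[OF \<open>V \<noteq> {}\<close>]
    by (intro cINF_greatest) (auto simp: best_approximation_def dist_norm)
qed

theorem theorem2p7:
  fixes T A :: "'a::banach \<Rightarrow>\<^sub>L 'b::banach"
    and lambda0 :: real
    and D :: "'a set"
  assumes "reflexive_space TYPE('a)"
    and "T \<in> compact_operators" and "A \<in> compact_operators"
    and "T \<notin> span {A}"
    and "best_approximation T (span {A}) (lambda0 *\<^sub>R A)"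
    and "D \<subseteq> sphere 0 1" and "connected D"
    and "norm_attainment_set (T - lambda0 *\<^sub>R A) = D \<union> uminus ` D"
  shows "\<exists>p :: 'b \<Rightarrow> 'b \<Rightarrow> real. semi_inner_product p \<and>
           is_maximum (infdist T (span {A}))
             {\<bar>p (blinfun_apply T x) y\<bar> | x y.
                x \<in> sphere 0 1 \<and> y \<in> sphere 0 1 \<and> p (blinfun_apply A x) y = 0}"
proof -
  define S where "S = T - lambda0 *\<^sub>R A"
  have span: "k *\<^sub>R A \<in> span {A}" for k by (simp add: span_base span_scale)
  have nz: "S \<noteq> 0" using assms(4) span[of lambda0] by (auto simp: S_def)
  have orth: "birkhoff_orthogonal S A"
    unfolding birkhoff_orthogonal_def
  proof
    fix t
    have "norm S \<le> norm (T - (lambda0 - t) *\<^sub>R A)"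
      using assms(5) span by (auto simp: best_approximation_def S_def)
    then show "norm S \<le> norm (S + t *\<^sub>R A)" by (simp add: S_def algebra_simps)
  qed
  obtain x where x: "x \<in> norm_attainment_set S"
    and xo: "birkhoff_orthogonal (blinfun_apply S x) (blinfun_apply A x)"
    using norm_attained_with_birkhoff_orthogonal[where T = T and A = A and c = lambda0 and D = D] assms nz orth
    unfolding S_def by blast
  have x1: "x \<in> sphere 0 1" and Sx: "norm (blinfun_apply S x) = norm S"
    using x by (auto simp: norm_attainment_set_def)
  obtain f :: "'b \<Rightarrow>\<^sub>L real" where f: "\<And>y. \<bar>blinfun_apply f y\<bar> \<le> norm y"
    and fS: "blinfun_apply f (blinfun_apply S x) = norm S"
    and fA: "blinfun_apply f (blinfun_apply A x) = 0"
    using birkhoff_orthogonal_support_functional[OF xo] Sx by metis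
  define w where "w = blinfun_apply S x /\<^sub>R norm S"
  have w: "norm w = 1" "blinfun_apply f w = 1"
    using nz Sx fS by (auto simp: w_def blinfun.scaleR_right)
  obtain p where p: "semi_inner_product p" and pw: "\<And>y. p y w = blinfun_apply f y"
    using semi_inner_product_with_support_functional[OF w(1) f w(2)] by blast
  have TS: "p (blinfun_apply T y) z = p (blinfun_apply S y) z"
    if "p (blinfun_apply A y) z = 0" for y z
  proof -
    have "p (1 *\<^sub>R blinfun_apply S y + lambda0 *\<^sub>R blinfun_apply A y) z
        = 1 * p (blinfun_apply S y) z + lambda0 * p (blinfun_apply A y) z"
      using p unfolding semi_inner_product_def by blast
    then show ?thesis using that by (simp add: S_def blinfun.diff_left blinfun.scaleR_left)
  qed
  have "is_maximum (norm S) {\<bar>p (blinfun_apply T x) y\<bar> | x y.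
      x \<in> sphere 0 1 \<and> y \<in> sphere 0 1 \<and> p (blinfun_apply A x) y = 0}"
    unfolding is_maximum_def
  proof (intro conjI ballI)
    have A0: "p (blinfun_apply A x) w = 0" using fA pw by simp
    have "norm S = \<bar>p (blinfun_apply T x) w\<bar>" using TS[OF A0] fS pw by simp
    then show "norm S \<in> {\<bar>p (blinfun_apply T x) y\<bar> | x y.
      x \<in> sphere 0 1 \<and> y \<in> sphere 0 1 \<and> p (blinfun_apply A x) y = 0}"
      using A0 x1 w(1) by force
  next
    fix s
    assume "s \<in> {\<bar>p (blinfun_apply T x) y\<bar> | x y.
      x \<in> sphere 0 1 \<and> y \<in> sphere 0 1 \<and> p (blinfun_apply A x) y = 0}"
    then obtain y z where yz: "s = \<bar>p (blinfun_apply T y) z\<bar>" "norm y = 1" "norm z = 1"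
      "p (blinfun_apply A y) z = 0" by auto
    have "s \<le> norm (blinfun_apply S y) * norm z"
      using semi_inner_product_cauchy_schwarz[OF p] TS[OF yz(4)] yz(1) by simp
    then show "s \<le> norm S" using norm_blinfun[of S y] yz by simp
  qed
  moreover have "infdist T (span {A}) = norm S"
    using infdist_best_approximation[OF assms(5)] by (simp add: S_def)
  ultimately show ?thesis using p by auto
qed

end
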